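(* Let $\varphi$ be the probability density function in the integral $\int_{\mathbb R^s}F(x)\varphi(x)\,dx$ and let $\psi,\omega$ be the weight functions used in the norm $\|F\|_{\gamma,\varphi,\psi,\omega}$ (see context). Let $\nu>0$ and let $$\varphi(x)=f_{\mathrm{stu},\nu}(x),\qquad\psi(x)=f_{\mathrm{stu},\nu}^{\eta-1}(x),\qquad\omega(x)=\frac{\nu+1}{\nu}\,\frac1{c_\nu^{2/(\nu+1)}}\,|x|\,f_{\mathrm{stu},\nu}^{\eta-1+\frac2{\nu+1}}(x)$$ with $\eta\in[0,\frac{\nu}{\nu+1}]$, where $f_{\mathrm{stu},\nu}(x)=c_\nu\left(1+\frac{x^2}{\nu}\right)^{-(\nu+1)/2}$, $c_\nu=\frac{\Gamma((\nu+1)/2)}{\sqrt{\pi\nu}\,\Gamma(\nu/2)}$, is the density of Student's $t$-distribution with $\nu$ degrees of freedom. Then the corresponding $\beta$ in Assumption A (see context) may be chosen to be $$\beta=1-\frac{\nu+1}{\nu}\,\eta,$$ with a corresponding $C=C_{\nu,\eta}$ given by $$C_{\nu,\eta}=\frac1{2c_\nu^\eta}\sup_{0\le x\le1/2}x\left(\frac{\nu+1}\nu+\frac2\nu\left(\frac{A_\nu}{2x}\right)^{1/\nu}+\frac1\nu\left(\frac{A_\nu}{2x}\right)^{2/\nu}\right)^{\eta(\nu+1)/2}<\infty,\qquad A_\nu=\frac{2c_\nu}{\nu}(\nu+1)^{(\nu+1)/2}.$$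
   Context: For $x\in\mathbb R^s$, $\varphi(x)=\prod_{j=1}^s\varphi(x_j)$. With $[s]=\{1,\dots,s\}$ and positive weights $\gamma_u$ ($u\subseteq[s]$), the norm is $\|F\|_{\gamma,\varphi,\psi,\omega}=\max_{\emptyset\ne u\subseteq[s],\,v\subseteq u}\frac1{\gamma_u}\|F\|_{u,v}$, where $$\|F\|_{u,v}=\sum_{w\subseteq v}\int_{\mathbb R^{|u|}}\left|\int_{\mathbb R^{s-|u|}}\frac{\partial^{|u|+|w|}F}{\partial x_w\,\partial x_u}(x)\prod_{j\in[s]\setminus u}\varphi(x_j)\,dx_{[s]\setminus u}\right|\prod_{j\in w}\psi(x_j)\prod_{j\in v\setminus w}\omega(x_j)\,dx_u.$$ Walsh functions: for $k=\sum_{i\ge0}\kappa_i2^i\in\{0,1,2,\dots\}$ and $x=\sum_{i\ge1}\xi_i2^{-i}\in[0,1)$ (binary digits, infinitely many $\xi_i\ne1$), $\mathrm{wal}_k(x)=(-1)^{\sum_{i\ge0}\kappa_i\xi_{i+1}}$. For integers $a_1>a_2\ge0$, $k=2^{a_1}+2^{a_2}$ and $m\in\{0,\dots,2^{a_2}-1\}$: $w_{k,m,2}(x)=2^{a_2/2}\mathbf 1_{[m/2^{a_2},(m+1)/2^{a_2})}(x)\,\mathrm{wal}_k(x)$ on $[0,1)$, $W_{k,m,2}(x)=\int_0^xw_{k,m,2}(y)\,dy$, $\widetilde W_{k,m,2}(x)=\int_0^xW_{k,m,2}(y)\,dy$, and $\widetilde W^{(\varphi)}_{k,m,2}(x)=\widetilde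 W_{k,m,2}(\Phi(x))$ for $x\in\mathbb R$, where $\Phi$ is the CDF of the univariate density $\varphi$. Assumption A, for a probability density function $\varphi$ on $\mathbb R$ and weight functions $\psi,\omega:\mathbb R\to(0,\infty)$: there exist reals $C>0$ and $\beta\in(0,1]$ such that for all $k=2^{a_1}+2^{a_2}$ with integers $a_1>a_2\ge0$ and all $m\in\{0,\dots,2^{a_2}-1\}$, $$\sup_{x\in\mathbb R}\frac{|\widetilde W^{(\varphi)}_{k,m,2}(x)|}{\varphi(x)\psi(x)}\le C\,\frac{2^{a_2/2}}{2^{a_1+\beta a_2}}\quad\text{and}\quad\sup_{x\in\mathbb R}\frac{|\widetilde W^{(\varphi)}_{k,m,2}(x)\varphi'(x)|}{\varphi^2(x)\omega(x)}\le C\,\frac{2^{a_2/2}}{2^{a_1+\beta a_2}}.$$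
   Formalization: At η=ν/(ν+1), β=0 lies outside (0,1], so only the two bounds with C finite and positive are claimed there, full Assumption A for η<ν/(ν+1); as ω(0)=0, positivity of ω is dropped and the second quotient, 0/0 at x=0, is taken as 0. *)

theory Defs
  imports "HOL-Probability.Probability"
begin

(* The i-th binary digit (i >= 1) of x in [0,1), for the expansion with
   infinitely many digits different from 1. *)
definition binary_digit :: "nat \<Rightarrow> real \<Rightarrow> nat" where
  "binary_digit i x = nat (\<lfloor>2 ^ i * x\<rfloor> mod 2)"

(* k div 2 ^ i mod 2 is the i-th binary digit of k; it vanishes for i >= k since k < 2 ^ k. *)
definition walsh :: "nat \<Rightarrow> real \<Rightarrow> real" where
  "walsh k x = (- 1) ^ (\<Sum>i<k. (k div 2 ^ i mod 2) * binary_digit (i + 1) x)"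

(* For a1 > a2, the number k = 2 ^ a1 + 2 ^ a2 determines a1 and a2, so the functions
   indexed by (k, m) are given the arguments a1, a2, m. *)
definition walsh_wavelet :: "nat \<Rightarrow> nat \<Rightarrow> nat \<Rightarrow> real \<Rightarrow> real" where
  "walsh_wavelet a1 a2 m x =
     2 powr (real a2 / 2) * indicator {real m / 2 ^ a2..<real (m + 1) / 2 ^ a2} x *
     walsh (2 ^ a1 + 2 ^ a2) x"

definition walsh_wavelet_int :: "nat \<Rightarrow> nat \<Rightarrow> nat \<Rightarrow> real \<Rightarrow> real" where
  "walsh_wavelet_int a1 a2 m x = integral {0..x} (walsh_wavelet a1 a2 m)"

definition walsh_wavelet_int2 :: "nat \<Rightarrow> nat \<Rightarrow> nat \<Rightarrow> real \<Rightarrow> real" where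
  "walsh_wavelet_int2 a1 a2 m x = integral {0..x} (walsh_wavelet_int a1 a2 m)"

definition density_cdf :: "(real \<Rightarrow> real) \<Rightarrow> real \<Rightarrow> real" where
  "density_cdf \<phi> = cdf (density lborel (\<lambda>x. ennreal (\<phi> x)))"

definition transformed_int2 ::
    "(real \<Rightarrow> real) \<Rightarrow> nat \<Rightarrow> nat \<Rightarrow> nat \<Rightarrow> real \<Rightarrow> real" where
  "transformed_int2 \<phi> a1 a2 m x = walsh_wavelet_int2 a1 a2 m (density_cdf \<phi> x)"

(* Suprema and quotients are taken in the extended reals: an unbounded quotient has supremum
   \<infinity>, and a quotient c / 0 with c > 0 equals \<infinity>, so a zero of a weight does not make
   the bound hold vacuously at that point. The only other convention is 0 / 0 = 0. *)
definition assumption_A_bounds ::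
    "(real \<Rightarrow> real) \<Rightarrow> (real \<Rightarrow> real) \<Rightarrow> (real \<Rightarrow> real) \<Rightarrow> real \<Rightarrow> real \<Rightarrow> bool" where
  "assumption_A_bounds \<phi> \<psi> \<omega> C \<beta> \<longleftrightarrow>
     (\<forall>a1 a2 m :: nat. a2 < a1 \<longrightarrow> m < 2 ^ a2 \<longrightarrow>
        (SUP x. ereal \<bar>transformed_int2 \<phi> a1 a2 m x\<bar> / ereal (\<phi> x * \<psi> x))
          \<le> ereal (C * (2 powr (real a2 / 2) / 2 powr (real a1 + \<beta> * real a2))) \<and>
        (SUP x. ereal \<bar>transformed_int2 \<phi> a1 a2 m x * deriv \<phi> x\<bar> / ereal ((\<phi> x)\<^sup>2 * \<omega> x))
          \<le> ereal (C * (2 powr (real a2 / 2) / 2 powr (real a1 + \<beta> * real a2))))"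

definition assumption_A_with ::
    "(real \<Rightarrow> real) \<Rightarrow> (real \<Rightarrow> real) \<Rightarrow> (real \<Rightarrow> real) \<Rightarrow> real \<Rightarrow> real \<Rightarrow> bool" where
  "assumption_A_with \<phi> \<psi> \<omega> C \<beta> \<longleftrightarrow>
     0 < C \<and> 0 < \<beta> \<and> \<beta> \<le> 1 \<and> assumption_A_bounds \<phi> \<psi> \<omega> C \<beta>"

definition student_c :: "real \<Rightarrow> real" where
  "student_c \<nu> = Gamma ((\<nu> + 1) / 2) / (sqrt (pi * \<nu>) * Gamma (\<nu> / 2))"

definition student_density :: "real \<Rightarrow> real \<Rightarrow> real" where
  "student_density \<nu> x = student_c \<nu> * (1 + x\<^sup>2 / \<nu>) powr (- ((\<nu> + 1) / 2))"

definition student_A :: "real \<Rightarrow> real" where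
  "student_A \<nu> = 2 * student_c \<nu> / \<nu> * (\<nu> + 1) powr ((\<nu> + 1) / 2)"

(* At x = 0 this evaluates to 0. As the values for x > 0 are positive, the supremum over
   [0,1/2] is the supremum over (0,1/2]. *)
definition student_C_fun :: "real \<Rightarrow> real \<Rightarrow> real \<Rightarrow> real" where
  "student_C_fun \<nu> \<eta> x =
     x * ((\<nu> + 1) / \<nu>
          + 2 / \<nu> * (student_A \<nu> / (2 * x)) powr (1 / \<nu>)
          + 1 / \<nu> * (student_A \<nu> / (2 * x)) powr (2 / \<nu>)) powr (\<eta> * (\<nu> + 1) / 2)"

definition student_C :: "real \<Rightarrow> real \<Rightarrow> real" where
  "student_C \<nu> \<eta> =
     1 / (2 * student_c \<nu> powr \<eta>) * (SUP x\<in>{0..1 / 2}. student_C_fun \<nu> \<eta> x)"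

end

theory Submission
  imports Defs
begin

text \<open>Two facts carry the proof: the twice integrated wavelet is at most linear in the distance to the
boundary of its dyadic cell, and the quantiles of Student's distribution grow at most like the power
\<open>-1/\<nu>\<close> of the tail probability.

The Walsh function with index \<open>2^a1 + 2^a2\<close> is a product of two Rademacher functions. On the cell
\<open>[m / 2^a2, (m + 1) / 2^a2)\<close> the slow factor is \<open>1\<close> on the left half and \<open>-1\<close> on the right half,
while the fast one integrates to a periodic tent function with values in \<open>[0, 2^(-a1-1)]\<close> that vanishes
at the ends and at the centre of the cell. Hence the first antiderivative \<open>W\<close> of the wavelet is
\<open>2^(a2/2)\<close> times the tent on the left half, the negative of that on the right half, and zero elsewhere.
By periodicity both halves contribute the same mass, so the second antiderivative also vanishes outside
the cell, and inside it is at most \<open>2^(a2/2) * 2^(-a1-1)\<close> times the distance \<open>d\<close> to the nearer end point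
(\<open>wavelet_int2_bound\<close>).

Both quotients in Assumption A are the same away from the origin: \<open>\<omega>\<close> is chosen such that
\<open>\<phi>\<^sup>2 \<omega> = \<bar>\<phi>'\<bar> \<phi> powr \<eta>\<close> (\<open>student_second_weight\<close>), and \<open>\<phi> \<psi> = \<phi> powr \<eta>\<close>. So the second antiderivative at \<open>\<Phi> t\<close>
has to be compared with \<open>\<phi> t powr \<eta>\<close>. When \<open>\<Phi> t\<close> has distance \<open>d\<close> to the boundary of the cell,
both \<open>\<Phi> t\<close> and \<open>1 - \<Phi> t\<close> are at least \<open>d\<close>. Since \<open>(s - 1)\<^sup>2 \<le> (\<nu> + 1) (1 + s\<^sup>2 / \<nu>)\<close>, the density is below a
shifted power, its tails are explicitly integrable, and this forces
\<open>\<bar>t\<bar> \<le> 1 + (A / (2 d)) powr (1 / \<nu>)\<close> (\<open>student_quantile_bound\<close>). Inserting this into the density and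
rescaling \<open>d = z / 2^a2\<close> with \<open>z \<le> 1/2\<close> gives precisely the function under the supremum in the constant,
at the price of the factor \<open>2^a2\<close> to the power \<open>\<eta> (\<nu> + 1) / \<nu>\<close>, which is the loss \<open>1 - \<beta>\<close>
(\<open>student_density_growth\<close>). The supremum is finite because this exponent is at most \<open>1\<close>, so the
singularity at zero is compensated by the factor \<open>z\<close> (\<open>student_C_fun_le\<close>).\<close>

section \<open>Rademacher functions and their tent antiderivatives\<close>

definition rademacher :: "nat \<Rightarrow> real \<Rightarrow> real" where
  "rademacher a x = (- 1) ^ binary_digit (a + 1) x"

lemma rademacher_eq: "rademacher a x = (if even \<lfloor>2 ^ (a + 1) * x\<rfloor> then 1 else - 1)"
proof (cases "even \<lfloor>2 ^ (a + 1) * x\<rfloor>")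
  case True
  then have "\<lfloor>2 ^ (a + 1) * x\<rfloor> mod 2 = 0" by (rule even_iff_mod_2_eq_zero[THEN iffD1])
  with True show ?thesis unfolding rademacher_def binary_digit_def by simp
next
  case False
  then have "\<lfloor>2 ^ (a + 1) * x\<rfloor> mod 2 = 1" by (rule odd_iff_mod_2_eq_one[THEN iffD1])
  with False show ?thesis unfolding rademacher_def binary_digit_def by simp
qed

text \<open>The two summands have disjoint binary expansions, so their sum is their bitwise disjunction.\<close>
lemma binary_digit_of_sum_two_powers:
  assumes "a2 < (a1::nat)"
  shows "(2 ^ a1 + 2 ^ a2) div 2 ^ i mod 2 = (of_bool (i = a1 \<or> i = a2) :: nat)"
proof -
  have "(2 ^ a1 + 2 ^ a2 :: nat) = Bit_Operations.or (2 ^ a1) (2 ^ a2)"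
    using assms by (intro disjunctive_add_eq_or bit_eqI) (auto simp: bit_simps)
  moreover have "bit (Bit_Operations.or (2 ^ a1) (2 ^ a2) :: nat) i \<longleftrightarrow> i = a1 \<or> i = a2"
    by (auto simp: bit_simps)
  ultimately show ?thesis
    by (auto simp: bit_iff_odd mod2_eq_if)
qed

text \<open>Only the two digits that are set in the index survive in the exponent of the Walsh function.\<close>
lemma walsh_two_powers:
  assumes "a2 < (a1::nat)"
  shows "walsh (2 ^ a1 + 2 ^ a2) x = rademacher a1 x * rademacher a2 x"
proof -
  define k :: nat where "k = 2 ^ a1 + 2 ^ a2"
  have "a1 < 2 ^ a1" "a2 < 2 ^ a2" by (rule less_exp)+
  then have lt: "{a1, a2} \<subseteq> {..<k}" by (simp add: k_def trans_less_add1 trans_less_add2)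
  have "(\<Sum>i<k. (k div 2 ^ i mod 2) * binary_digit (i + 1) x) =
      (\<Sum>i<k. if i \<in> {a1, a2} then binary_digit (i + 1) x else 0)"
    by (rule sum.cong) (auto simp: k_def binary_digit_of_sum_two_powers[OF assms])
  also have "\<dots> = (\<Sum>i\<in>{a1, a2}. binary_digit (i + 1) x)"
    using lt by (subst sum.inter_restrict[symmetric]) (auto intro: sum.cong)
  also have "\<dots> = binary_digit (a1 + 1) x + binary_digit (a2 + 1) x"
    using assms by simp
  finally show ?thesis
    unfolding walsh_def k_def[symmetric] by (simp add: rademacher_def power_add)
qed

text \<open>Walsh functions are constant on half-open intervals, while the integrals run over closed ones: a single
point carries no mass.\<close>
lemma has_integral_const_right_open:
  fixes f :: "real \<Rightarrow> real"
  assumes "u \<le> v" and f: "\<And>z. u \<le> z \<Longrightarrow> z < v \<Longrightarrow> f z = c"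
  shows "(f has_integral c * (v - u)) {u..v}"
proof (rule has_integral_spike_finite)
  show "finite {v}" by simp
  show "f z = c" if "z \<in> {u..v} - {v}" for z
    using that f by simp
  show "((\<lambda>_. c) has_integral c * (v - u)) {u..v}"
    using has_integral_const_real[of c u v] assms(1) by (simp add: mult.commute)
qed

text \<open>The distance from \<open>x\<close> to the nearest multiple of \<open>2^(-a)\<close>. Writing it with \<open>frac\<close> makes periodicity,
the zeros on the grid and the bounds immediate.\<close>
definition tent :: "nat \<Rightarrow> real \<Rightarrow> real" where
  "tent a x = min (frac (2 ^ a * x)) (1 - frac (2 ^ a * x)) / 2 ^ a"

lemma tent_nonneg: "0 \<le> tent a x"
  by (simp add: tent_def frac_lt_1 less_imp_le)

lemma tent_le: "tent a x \<le> 1 / (2 * 2 ^ a)"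
proof -
  have "min (frac (2 ^ a * x)) (1 - frac (2 ^ a * x)) \<le> 1 / 2" by linarith
  then show ?thesis by (simp add: tent_def field_simps)
qed

lemma tent_periodic: "tent a (x + of_int n / 2 ^ a) = tent a x"
  by (simp add: tent_def distrib_left frac_def)

lemma tent_grid: "tent a (of_int n / 2 ^ a) = 0"
  by (simp add: tent_def)

lemma rademacher_has_integral_in_cell:
  fixes n :: int
  assumes "of_int n / 2 ^ a \<le> x" and "x \<le> (of_int n + 1) / 2 ^ a"
  shows "(rademacher a has_integral min (x - of_int n / 2 ^ a) ((of_int n + 1) / 2 ^ a - x))
           {of_int n / 2 ^ a..x}"
proof -
  define l where "l = of_int n / (2::real) ^ a"
  \<comment> \<open>the centre of the cell, where the Rademacher function changes sign\<close>
  define c where "c = (of_int n + 1 / 2) / (2::real) ^ a"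
  define r where "r = (of_int n + 1) / (2::real) ^ a"
  have lcr: "c - l = r - c" "l < c"
    by (simp_all add: l_def c_def r_def divide_strict_right_mono flip: diff_divide_distrib)
  have left: "(rademacher a has_integral (y - l)) {l..y}" if "l \<le> y" "y \<le> c" for y
  proof -
    have "\<lfloor>2 ^ (a + 1) * z\<rfloor> = 2 * n" if "l \<le> z" "z < c" for z
      using that by (intro floor_unique) (auto simp: l_def c_def field_simps)
    then show ?thesis
      using that has_integral_const_right_open[of l y "rademacher a" 1] by (simp add: rademacher_eq)
  qed
  have right: "(rademacher a has_integral - (y - c)) {c..y}" if "c \<le> y" "y \<le> r" for y
  proof -
    have "\<lfloor>2 ^ (a + 1) * z\<rfloor> = 2 * n + 1" if "c \<le> z" "z < r" for z
      using that by (intro floor_unique) (auto simp: r_def c_def field_simps)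
    then show ?thesis
      using that has_integral_const_right_open[of c y "rademacher a" "- 1"] by (simp add: rademacher_eq)
  qed
  have "(rademacher a has_integral min (x - l) (r - x)) {l..x}"
  proof (cases "x \<le> c")
    case True
    then show ?thesis using left[of x] lcr assms(1) by (simp add: l_def[symmetric] min_def)
  next
    case False
    then have "(rademacher a has_integral (c - l) + - (x - c)) {l..x}"
      using lcr assms(2) left[of c] right[of x]
      by (intro has_integral_combine[of l c x]) (auto simp: r_def[symmetric])
    then show ?thesis using lcr False by (simp add: min_def)
  qed
  then show ?thesis by (simp add: l_def r_def)
qed

lemma rademacher_has_integral_cells:
  fixes M N :: int
  assumes "M \<le> N"
  shows "(rademacher a has_integral 0) {of_int M / 2 ^ a..of_int N / 2 ^ a}"
  using assms
proof (induction N rule: int_ge_induct)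
  case base
  then show ?case by (simp add: has_integral_refl)
next
  case (step N)
  have "(rademacher a has_integral 0) {of_int N / 2 ^ a..(of_int N + 1) / 2 ^ a}"
    using rademacher_has_integral_in_cell[of N a "(of_int N + 1) / 2 ^ a"]
    by (simp add: divide_right_mono)
  then have "(rademacher a has_integral 0 + 0) {of_int M / 2 ^ a..(of_int N + 1) / 2 ^ a}"
    using step by (intro has_integral_combine[of _ "of_int N / 2 ^ a"]) (auto simp: divide_right_mono)
  then show ?case by simp
qed

text \<open>The two halves of every period cancel, so the antiderivative may start at any grid point on the left,
and only the cell containing \<open>x\<close> contributes.\<close>
lemma rademacher_has_integral_tent:
  fixes M :: int
  assumes "of_int M / 2 ^ a \<le> x"
  shows "(rademacher a has_integral tent a x) {of_int M / 2 ^ a..x}"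
proof -
  define n where "n = \<lfloor>2 ^ a * x\<rfloor>"
  have n: "of_int n / 2 ^ a \<le> x" "x \<le> (of_int n + 1) / 2 ^ a"
    unfolding n_def by (simp_all add: field_simps) linarith
  have "M \<le> n" unfolding n_def using assms by (simp add: le_floor_iff field_simps)
  then have "(rademacher a has_integral 0 + min (x - of_int n / 2 ^ a) ((of_int n + 1) / 2 ^ a - x))
      {of_int M / 2 ^ a..x}"
    using n rademacher_has_integral_cells rademacher_has_integral_in_cell[OF n]
    by (intro has_integral_combine[of _ "of_int n / 2 ^ a"]) (auto simp: divide_right_mono)
  also have "0 + min (x - of_int n / 2 ^ a) ((of_int n + 1) / 2 ^ a - x) = tent a x"
    by (simp add: tent_def frac_def n_def min_divide_distrib_right field_simps)
  finally show ?thesis .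
qed

text \<open>The tent is continuous because it is an indefinite integral, started at the grid point below \<open>u\<close>.\<close>
lemma tent_integrable_on: "tent a integrable_on {u..v}"
proof -
  define s where "s = of_int \<lfloor>2 ^ a * u\<rfloor> / (2::real) ^ a"
  have s: "s \<le> u" by (simp add: s_def field_simps)
  have T: "integral {s..x} (rademacher a) = tent a x" if "x \<in> {s..v}" for x
    unfolding s_def by (intro integral_unique rademacher_has_integral_tent) (use that in \<open>simp add: s_def\<close>)
  have "continuous_on {s..v} (tent a)"
  proof (cases "s \<le> v")
    case True
    then have "rademacher a integrable_on {s..v}"
      unfolding s_def by (rule has_integral_integrable[OF rademacher_has_integral_tent])
    then have "continuous_on {s..v} (\<lambda>x. integral {s..x} (rademacher a))"
      by (rule indefinite_integral_continuous_1)
    moreover have "continuous_on {s..v} (tent a) \<longleftrightarrow>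
        continuous_on {s..v} (\<lambda>x. integral {s..x} (rademacher a))"
      by (rule continuous_on_cong[OF refl]) (rule T[symmetric])
    ultimately show ?thesis by (rule iffD2[rotated])
  qed simp
  then have "continuous_on {u..v} (tent a)"
    by (rule continuous_on_subset) (use s in auto)
  then show ?thesis
    by (rule integrable_continuous_interval)
qed

lemma integral_tent_nonneg: "0 \<le> integral {u..v} (tent a)"
  by (intro integral_nonneg tent_integrable_on tent_nonneg)

lemma integral_tent_le:
  assumes "u \<le> v"
  shows "integral {u..v} (tent a) \<le> (v - u) / (2 * 2 ^ a)"
proof -
  have "integral {u..v} (tent a) \<le> integral {u..v} (\<lambda>_. 1 / (2 * 2 ^ a))"
    by (intro integral_le tent_integrable_on integrable_const_ivl tent_le)
  also have "\<dots> = (v - u) / (2 * 2 ^ a)"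
    using assms by simp
  finally show ?thesis .
qed

lemma integral_tent_shift:
  "integral {u + of_int n / 2 ^ a..v + of_int n / 2 ^ a} (tent a) = integral {u..v} (tent a)"
  using integral_shift_real_ivl[of "u + of_int n / 2 ^ a" "of_int n / 2 ^ a" "v + of_int n / 2 ^ a" "tent a"]
  by (simp add: tent_periodic)

text \<open>End points and centre of a cell of the coarse scale \<open>a2\<close> are grid points of the finer scale \<open>a1\<close>,
hence zeros of the tent.\<close>
lemma dyadic_refine:
  fixes n :: int
  assumes "b \<le> (a::nat)"
  shows "of_int n / (2::real) ^ b = of_int (n * 2 ^ (a - b)) / 2 ^ a"
  using assms power_add[of "2::real" "a - b" b] by (simp add: field_simps)

section \<open>The integrated Walsh wavelets\<close>

lemma has_integral_zero_on:
  fixes f :: "real \<Rightarrow> real"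
  assumes "u \<le> v" and "\<And>z. u \<le> z \<Longrightarrow> z < v \<Longrightarrow> f z = 0"
  shows "(f has_integral 0) {u..v}"
  using has_integral_const_right_open[of u v f 0] assms by simp

text \<open>One wavelet, together with names for its cell. The centre is where the Rademacher factor of scale \<open>a2\<close>
changes sign.\<close>
locale wavelet_cell =
  fixes a1 a2 m :: nat
  assumes less: "a2 < a1"
begin

definition left_end :: real where "left_end = real m / 2 ^ a2"
definition centre :: real where "centre = (2 * real m + 1) / 2 ^ (a2 + 1)"
definition right_end :: real where "right_end = (real m + 1) / 2 ^ a2"
definition height :: real where "height = 2 powr (real a2 / 2)"

lemma cell_order: "0 \<le> left_end" "left_end < centre" "centre < right_end"
  by (auto simp: left_end_def centre_def right_end_def field_simps)

lemma centre_conv: "centre = left_end + 1 / 2 ^ (a2 + 1)" "right_end = centre + 1 / 2 ^ (a2 + 1)"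
  by (auto simp: left_end_def centre_def right_end_def field_simps)

lemma cell_grid:
  obtains nl nc nr :: int where "left_end = of_int nl / 2 ^ a1" "centre = of_int nc / 2 ^ a1"
    "right_end = of_int nr / 2 ^ a1"
proof
  show "left_end = of_int (int m * 2 ^ (a1 - a2)) / 2 ^ a1"
    using dyadic_refine[of a2 a1 "int m"] less by (simp add: left_end_def)
  show "centre = of_int ((2 * int m + 1) * 2 ^ (a1 - (a2 + 1))) / 2 ^ a1"
    using dyadic_refine[of "a2 + 1" a1 "2 * int m + 1"] less by (simp add: centre_def)
  show "right_end = of_int ((int m + 1) * 2 ^ (a1 - a2)) / 2 ^ a1"
    using dyadic_refine[of a2 a1 "int m + 1"] less by (simp add: right_end_def)
qed

lemma tent_cell: "tent a1 left_end = 0" "tent a1 centre = 0" "tent a1 right_end = 0"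
  using cell_grid by (metis tent_grid)+

lemma wavelet_piecewise:
  "walsh_wavelet a1 a2 m x =
     (if left_end \<le> x \<and> x < centre then height * rademacher a1 x
      else if centre \<le> x \<and> x < right_end then - height * rademacher a1 x
      else 0)"
proof -
  have l: "rademacher a2 x = 1" if "left_end \<le> x" "x < centre"
  proof -
    have "\<lfloor>2 ^ (a2 + 1) * x\<rfloor> = 2 * int m"
      using that by (intro floor_unique) (auto simp: left_end_def centre_def field_simps)
    then show ?thesis by (simp add: rademacher_eq)
  qed
  have r: "rademacher a2 x = - 1" if "centre \<le> x" "x < right_end"
  proof -
    have "\<lfloor>2 ^ (a2 + 1) * x\<rfloor> = 2 * int m + 1"
      using that by (intro floor_unique) (auto simp: right_end_def centre_def field_simps)
    then show ?thesis by (simp add: rademacher_eq)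
  qed
  have "walsh_wavelet a1 a2 m x = height * indicator {left_end..<right_end} x * (rademacher a1 x * rademacher a2 x)"
    by (simp add: walsh_wavelet_def walsh_two_powers[OF less] height_def left_end_def right_end_def add.commute)
  then show ?thesis
    using l r cell_order by (auto simp: indicator_def)
qed

text \<open>The tent vanishes at the ends and at the centre of the cell. Therefore the contribution of each half is
over when the next piece starts, and the first antiderivative is a signed tent supported in the cell.\<close>
lemma wavelet_int_eq:
  assumes "0 \<le> x"
  shows "walsh_wavelet_int a1 a2 m x =
     (if left_end \<le> x \<and> x \<le> centre then height * tent a1 x
      else if centre \<le> x \<and> x \<le> right_end then - height * tent a1 x
      else 0)"
proof -
  let ?w = "walsh_wavelet a1 a2 m"
  obtain nl nc nr where g: "left_end = of_int nl / 2 ^ a1" "centre = of_int nc / 2 ^ a1"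
    "right_end = of_int nr / 2 ^ a1"
    by (rule cell_grid)
  have w1: "(?w has_integral 0) {0..x}" if "0 \<le> x" "x \<le> left_end" for x
    using that cell_order by (intro has_integral_zero_on) (auto simp: wavelet_piecewise)
  have w2: "(?w has_integral height * tent a1 x) {0..x}" if "left_end \<le> x" "x \<le> centre" for x
  proof -
    have "((\<lambda>z. height * rademacher a1 z) has_integral height * tent a1 x) {left_end..x}"
      using that unfolding g by (intro has_integral_mult_right rademacher_has_integral_tent)
    then have "(?w has_integral height * tent a1 x) {left_end..x}"
      using that by (intro has_integral_spike_finite[of "{x}" _ ?w]) (auto simp: wavelet_piecewise)
    with w1[of left_end] have "(?w has_integral 0 + height * tent a1 x) {0..x}"
      using that cell_order by (intro has_integral_combine[of 0 left_end x]) auto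
    then show ?thesis by simp
  qed
  have w3: "(?w has_integral - height * tent a1 x) {0..x}" if "centre \<le> x" "x \<le> right_end" for x
  proof -
    have "((\<lambda>z. - height * rademacher a1 z) has_integral - height * tent a1 x) {centre..x}"
      using that unfolding g by (intro has_integral_mult_right rademacher_has_integral_tent)
    then have "(?w has_integral - height * tent a1 x) {centre..x}"
      using that by (intro has_integral_spike_finite[of "{x}" _ ?w]) (auto simp: wavelet_piecewise)
    with w2[of centre] have "(?w has_integral height * tent a1 centre + - height * tent a1 x) {0..x}"
      using that cell_order by (intro has_integral_combine[of 0 centre x]) auto
    then show ?thesis by (simp add: tent_cell)
  qed
  have w4: "(?w has_integral 0) {0..x}" if "right_end \<le> x" for x
  proof -
    have "(?w has_integral 0) {right_end..x}"
      using that cell_order by (intro has_integral_zero_on) (auto simp: wavelet_piecewise)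
    with w3[of right_end] have "(?w has_integral - height * tent a1 right_end + 0) {0..x}"
      using that cell_order by (intro has_integral_combine[of 0 right_end x]) auto
    then show ?thesis by (simp add: tent_cell)
  qed
  show ?thesis
    unfolding walsh_wavelet_int_def
    using w1[of x] w2[of x] w3[of x] w4[of x] assms by (auto intro!: integral_unique)
qed

text \<open>The halves of the cell are translates of each other by a multiple of the period of the tent. This is why
the second antiderivative returns to zero at the right end of the cell.\<close>
lemma integral_tent_halves: "integral {left_end..centre} (tent a1) = integral {centre..right_end} (tent a1)"
proof -
  have "(1::real) / 2 ^ (a2 + 1) = of_int (2 ^ (a1 - (a2 + 1))) / 2 ^ a1"
    using dyadic_refine[of "a2 + 1" a1 1] less by simp
  then show ?thesis
    using integral_tent_shift[of left_end "2 ^ (a1 - (a2 + 1))" a1 centre] centre_conv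
    by simp
qed

text \<open>On the left half the second antiderivative is the mass of the scaled tent between the left end and \<open>y\<close>.
On the right half the negative sign removes mass again, and what remains is the mass between \<open>y\<close> and
the right end. Either way the height of the tent turns this into a linear bound.\<close>
lemma wavelet_int2_bound:
  assumes "0 \<le> y"
  shows "\<bar>walsh_wavelet_int2 a1 a2 m y\<bar> \<le>
           height / (2 * 2 ^ a1) * max 0 (min (y - left_end) (right_end - y))"
proof -
  let ?W = "walsh_wavelet_int a1 a2 m"
  let ?I = "\<lambda>u v. integral {u..v} (tent a1)"
  have I: "(tent a1 has_integral ?I u v) {u..v}" for u v
    using tent_integrable_on by (rule integrable_integral)
  have W1: "(?W has_integral 0) {0..y}" if "0 \<le> y" "y \<le> left_end" for y
    using that cell_order by (intro has_integral_zero_on) (auto simp: wavelet_int_eq)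
  have W2: "(?W has_integral height * ?I left_end y) {0..y}" if "left_end \<le> y" "y \<le> centre" for y
  proof -
    have "(?W has_integral height * ?I left_end y) {left_end..y}"
      using that cell_order
      by (intro has_integral_eq[OF _ has_integral_mult_right[OF I]]) (auto simp: wavelet_int_eq)
    with W1[of left_end] have "(?W has_integral 0 + height * ?I left_end y) {0..y}"
      using that cell_order by (intro has_integral_combine[of 0 left_end y]) auto
    then show ?thesis by simp
  qed
  have W3: "(?W has_integral height * ?I y right_end) {0..y}" if "centre \<le> y" "y \<le> right_end" for y
  proof -
    have "(?W has_integral - height * ?I centre y) {centre..y}"
      using that cell_order
      by (intro has_integral_eq[OF _ has_integral_mult_right[OF I]]) (auto simp: wavelet_int_eq tent_cell)
    with W2[of centre] have "(?W has_integral height * ?I left_end centre + - height * ?I centre y) {0..y}"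
      using that cell_order by (intro has_integral_combine[of 0 centre y]) auto
    moreover have split: "?I centre y + ?I y right_end = ?I left_end centre"
      unfolding integral_tent_halves
      using that tent_integrable_on by (intro Henstock_Kurzweil_Integration.integral_combine) auto
    have "height * ?I left_end centre + - height * ?I centre y = height * ?I y right_end"
      unfolding split[symmetric] by (simp add: distrib_left)
    ultimately show ?thesis by simp
  qed
  have W4: "(?W has_integral 0) {0..y}" if "right_end \<le> y" for y
  proof -
    have "(?W has_integral 0) {right_end..y}"
      using that cell_order by (intro has_integral_zero_on) (auto simp: wavelet_int_eq tent_cell)
    with W3[of right_end] have "(?W has_integral height * ?I right_end right_end + 0) {0..y}"
      using that cell_order by (intro has_integral_combine[of 0 right_end y]) auto
    then show ?thesis by simp
  qed
  have height: "0 \<le> height" by (simp add: height_def)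
  have bound: "\<bar>height * ?I u v\<bar> \<le> height / (2 * 2 ^ a1) * (v - u)" if "u \<le> v" for u v
    using mult_left_mono[OF integral_tent_le[OF that, of a1] height] integral_tent_nonneg[of u v a1] height
    by (simp add: abs_mult)
  consider "y \<le> left_end" | "left_end \<le> y" "y \<le> centre" | "centre \<le> y" "y \<le> right_end" | "right_end \<le> y"
    by linarith
  then show ?thesis
  proof cases
    case 1
    then show ?thesis using W1[of y] height assms by (simp add: walsh_wavelet_int2_def integral_unique)
  next
    case 2
    then have "max 0 (min (y - left_end) (right_end - y)) = y - left_end"
      using centre_conv by simp
    with 2 show ?thesis
      using W2[of y] bound[of left_end y] by (simp add: walsh_wavelet_int2_def integral_unique)
  next
    case 3
    then have "max 0 (min (y - left_end) (right_end - y)) = right_end - y"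
      using centre_conv by simp
    with 3 show ?thesis
      using W3[of y] bound[of y right_end] by (simp add: walsh_wavelet_int2_def integral_unique)
  next
    case 4
    then show ?thesis using W4[of y] height by (simp add: walsh_wavelet_int2_def integral_unique)
  qed
qed

end

section \<open>Total mass and tails of Student's distribution\<close>

lemma student_c_pos:
  assumes "0 < \<nu>"
  shows "0 < student_c \<nu>"
  using assms unfolding student_c_def by (intro divide_pos_pos mult_pos_pos Gamma_real_pos) auto

lemma one_plus_square_over_pos:
  fixes x \<nu> :: real
  assumes "0 < \<nu>"
  shows "0 < 1 + x\<^sup>2 / \<nu>"
  using assms by (simp add: add_pos_nonneg)

lemma student_density_pos:
  assumes "0 < \<nu>"
  shows "0 < student_density \<nu> x"
  using student_c_pos[OF assms] one_plus_square_over_pos[OF assms, of x]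
  unfolding student_density_def by simp

lemma student_density_minus: "student_density \<nu> (- x) = student_density \<nu> x"
  by (simp add: student_density_def)

lemma borel_measurable_student_density [measurable]:
  "student_density \<nu> \<in> borel_measurable borel"
  unfolding student_density_def by measurable

text \<open>The substitution \<open>s = x\<^sup>2 / (\<nu> + x\<^sup>2)\<close> maps the half line onto the unit interval and turns the kernel into
the integrand of Euler's Beta integral with parameters \<open>1/2\<close> and \<open>\<nu>/2\<close>.\<close>
lemma student_kernel_integral_half_line:
  fixes \<nu> :: real
  assumes "0 < \<nu>"
  shows "((\<lambda>x. (1 + x\<^sup>2 / \<nu>) powr (- ((\<nu> + 1) / 2))) has_integral
           sqrt \<nu> / 2 * Beta (1 / 2) (\<nu> / 2)) {0<..}"
proof -
  define g where "g = (\<lambda>x::real. x\<^sup>2 / (\<nu> + x\<^sup>2))"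
  define g' where "g' = (\<lambda>x::real. 2 * \<nu> * x / (\<nu> + x\<^sup>2)\<^sup>2)"
  define f where "f = (\<lambda>s::real. s powr (1 / 2 - 1) * (1 - s) powr (\<nu> / 2 - 1))"
  have pos: "0 < \<nu> + x\<^sup>2" for x :: real
    using assms by (simp add: add_pos_nonneg)
  have der: "(g has_field_derivative g' x) (at x within {0<..})" for x
    unfolding g_def g'_def using pos[of x] assms
    by (auto intro!: derivative_eq_intros simp: field_simps power2_eq_square)
  have compl: "1 - g x = \<nu> / (\<nu> + x\<^sup>2)" for x
    using pos[of x] by (simp add: g_def field_simps)
  have inj: "inj_on g {0<..}"
  proof (rule inj_onI)
    fix x y :: real
    assume xy: "x \<in> {0<..}" "y \<in> {0<..}" "g x = g y"
    then have "\<nu> / (\<nu> + x\<^sup>2) = \<nu> / (\<nu> + y\<^sup>2)"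
      by (metis compl)
    then have "x\<^sup>2 = y\<^sup>2"
      using assms by (metis add_left_cancel divide_cancel_left less_irrefl)
    then show "x = y"
      using xy by simp
  qed
  have image: "g ` {0<..} = {0<..<1}"
  proof
    show "g ` {0<..} \<subseteq> {0<..<1}"
      using assms pos by (auto simp: g_def)
    show "{0<..<1} \<subseteq> g ` {0<..}"
    proof
      fix s :: real assume s: "s \<in> {0<..<1}"
      have "g (sqrt (\<nu> * s / (1 - s))) = s"
        using s assms by (simp add: g_def field_simps)
      moreover have "sqrt (\<nu> * s / (1 - s)) \<in> {0<..}"
        using s assms by simp
      ultimately show "s \<in> g ` {0<..}" by (metis image_eqI)
    qed
  qed
  have "(f has_integral Beta (1 / 2) (\<nu> / 2)) {0<..<1}"
    using has_integral_Beta_real[of "1 / 2" "\<nu> / 2"] assms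
    unfolding f_def by (simp add: has_integral_Icc_iff_Ioo)
  moreover from this have "f absolutely_integrable_on {0<..<1}"
    by (intro nonnegative_absolutely_integrable_1) (auto simp: f_def)
  ultimately have "f absolutely_integrable_on g ` {0<..} \<and> 
      integral (g ` {0<..}) f = Beta (1 / 2) (\<nu> / 2)"
    by (simp add: image has_integral_iff)
  then have "(\<lambda>x. \<bar>g' x\<bar> * f (g x)) absolutely_integrable_on {0<..} \<and>
      integral {0<..} (\<lambda>x. \<bar>g' x\<bar> * f (g x)) = Beta (1 / 2) (\<nu> / 2)"
    by (subst has_absolute_integral_change_of_variables_1'[OF _ der inj]) auto
  then have "((\<lambda>x. \<bar>g' x\<bar> * f (g x)) has_integral Beta (1 / 2) (\<nu> / 2)) {0<..}"
    using set_lebesgue_integral_eq_integral(1) by (auto simp: has_integral_iff)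
  then have "((\<lambda>x. sqrt \<nu> / 2 * (\<bar>g' x\<bar> * f (g x))) has_integral
      sqrt \<nu> / 2 * Beta (1 / 2) (\<nu> / 2)) {0<..}"
    by (rule has_integral_mult_right)
  moreover have "sqrt \<nu> / 2 * (\<bar>g' x\<bar> * f (g x)) = (1 + x\<^sup>2 / \<nu>) powr (- ((\<nu> + 1) / 2))"
    if "x \<in> {0<..}" for x
  proof -
    from that have x: "0 < x" by simp
    \<comment> \<open>All factors become powers of \<open>\<nu>\<close>, \<open>x\<close> and \<open>P\<close>; the powers of \<open>x\<close> cancel.\<close>
    define P where "P = \<nu> + x\<^sup>2"
    have P: "0 < P" using pos[of x] by (simp add: P_def)
    have "\<bar>g' x\<bar> = 2 * \<nu> powr 1 * x powr 1 * P powr (-2)"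
      using x assms P by (simp add: g'_def P_def powr_minus field_simps)
    moreover have "f (g x) = (x powr 2 / P) powr (-1/2) * (\<nu> / P) powr (\<nu>/2 - 1)"
      using x compl[of x] by (simp add: f_def P_def g_def)
    moreover have "(x powr 2 / P) powr (-1/2) = x powr (-1) * P powr (1/2)"
      using P by (simp add: powr_divide powr_powr powr_minus_divide)
    moreover have "(\<nu> / P) powr (\<nu>/2 - 1) = \<nu> powr (\<nu>/2 - 1) * P powr (1 - \<nu>/2)"
      using P assms powr_minus_divide[of P "\<nu>/2 - 1"] by (simp add: powr_divide)
    moreover have "sqrt \<nu> = \<nu> powr (1/2)"
      using assms by (simp add: powr_half_sqrt)
    ultimately have "sqrt \<nu> / 2 * (\<bar>g' x\<bar> * f (g x)) =
       (\<nu> powr (1/2) * \<nu> powr 1 * \<nu> powr (\<nu>/2-1)) * (x powr 1 * x powr (-1)) * (P powr (-2) * P powr (1/2) * P powr (1 - \<nu>/2))"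
      by simp
    also have "\<dots> = \<nu> powr ((\<nu>+1)/2) * P powr (- ((\<nu>+1)/2))"
    proof -
      have "1 / 2 + 1 + (\<nu> / 2 - 1) = (\<nu> + 1) / 2"
        "- 2 + 1 / 2 + (1 - \<nu> / 2) = - ((\<nu> + 1) / 2)" "1 + - 1 = (0::real)"
        by (simp_all add: field_simps)
      then show ?thesis
        using x by (simp only: powr_add[symmetric]) simp
    qed
    also have "\<dots> = (P / \<nu>) powr (- ((\<nu> + 1) / 2))"
      using P assms by (simp add: powr_divide powr_minus field_simps)
    also have "P / \<nu> = 1 + x\<^sup>2 / \<nu>"
      using assms by (simp add: P_def field_simps)
    finally show ?thesis .
  qed
  ultimately show ?thesis
    by (rule has_integral_eq[rotated]) 
qed

text \<open>The normalisation enters the estimates through the upper tail: \<open>1 - \<Phi> t\<close> is the mass to the right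
of \<open>t\<close> only because the total mass is one.\<close>
lemma student_density_total_mass:
  assumes "0 < \<nu>"
  shows "has_bochner_integral lborel (student_density \<nu>) 1"
proof -
  have "((\<lambda>x. student_density \<nu> x) has_integral
          student_c \<nu> * (sqrt \<nu> / 2 * Beta (1 / 2) (\<nu> / 2))) {0<..}"
    unfolding student_density_def
    by (rule has_integral_mult_right[OF student_kernel_integral_half_line[OF assms]])
  also have "student_c \<nu> * (sqrt \<nu> / 2 * Beta (1 / 2) (\<nu> / 2)) = 1 / 2"
  proof -
    have pos: "Gamma (\<nu> / 2) \<noteq> 0" "Gamma ((\<nu> + 1) / 2) \<noteq> 0"
      by (rule Gamma_real_pos[THEN less_imp_neq, THEN not_sym]; use assms in simp)+
    have "Beta (1 / 2) (\<nu> / 2) = sqrt pi * Gamma (\<nu> / 2) / Gamma ((\<nu> + 1) / 2)"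
      by (simp add: Beta_def Gamma_one_half_real add_divide_distrib add.commute)
    then show ?thesis
      using pos assms by (simp add: student_c_def real_sqrt_mult)
  qed
  finally have half: "(student_density \<nu> has_integral 1 / 2) {0..}"
    by (rule has_integral_spike_set_eq[THEN iffD1, rotated 2])
       (auto intro: negligible_subset[of "{0}"])
  have nonneg: "0 \<le> student_density \<nu> x" for x
    using student_density_pos[OF assms, of x] by simp
  have "(\<integral>\<^sup>+x. ennreal (indicator {0..} x *\<^sub>R student_density \<nu> x) \<partial>lborel) = ennreal (1 / 2)"
    using nn_integral_has_integral_lebesgue[OF nonneg half] by simp
  then have "has_bochner_integral lborel (\<lambda>x. indicator {0..} x *\<^sub>R student_density \<nu> x) (1 / 2)"
    using nonneg by (intro has_bochner_integral_nn_integral) auto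
  from has_bochner_integral_even_function[OF this student_density_minus]
  show ?thesis by simp
qed

abbreviation student_measure :: "real \<Rightarrow> real measure" where
  "student_measure \<nu> \<equiv> density lborel (\<lambda>x. ennreal (student_density \<nu> x))"

lemma prob_space_student:
  assumes "0 < \<nu>"
  shows "prob_space (student_measure \<nu>)"
proof (rule prob_spaceI)
  have nonneg: "0 \<le> student_density \<nu> x" for x
    using student_density_pos[OF assms, of x] by simp
  have "(\<integral>\<^sup>+x. ennreal (student_density \<nu> x) \<partial>lborel) = ennreal 1"
    using student_density_total_mass[OF assms] nonneg
    by (intro nn_integral_eq_integral[THEN trans]) (auto simp: has_bochner_integral_iff)
  then show "emeasure (student_measure \<nu>) (space (student_measure \<nu>)) = 1"
    by (simp add: emeasure_density)
qed

text \<open>The reason is the Cauchy--Schwarz inequality \<open>(s - 1)\<^sup>2 \<le> (\<nu> + 1) (1 + s\<^sup>2 / \<nu>)\<close> for the vectors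
\<open>(sqrt \<nu>, -1)\<close> and \<open>(s / sqrt \<nu>, 1)\<close>. The right-hand side has an elementary antiderivative, and
\<open>student_A\<close> is the constant that this produces.\<close>
lemma student_density_le_shifted_power:
  assumes "0 < \<nu>" and "1 < s"
  shows "student_density \<nu> s \<le> student_A \<nu> / 2 * \<nu> * (s - 1) powr (- \<nu> - 1)"
proof -
  \<comment> \<open>the defect in the Cauchy--Schwarz inequality is a square\<close>
  have "0 \<le> (s / \<nu> + 1)\<^sup>2 * \<nu>" using assms by simp
  also have "\<dots> = (\<nu> + 1) * (1 + s\<^sup>2 / \<nu>) - (s - 1)\<^sup>2"
    using assms by (simp add: field_simps power2_eq_square)
  finally have "(s - 1)\<^sup>2 / (\<nu> + 1) \<le> 1 + s\<^sup>2 / \<nu>"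
    using assms by (simp add: field_simps)
  then have "(1 + s\<^sup>2 / \<nu>) powr (- ((\<nu> + 1) / 2)) \<le> ((s - 1)\<^sup>2 / (\<nu> + 1)) powr (- ((\<nu> + 1) / 2))"
    using assms by (intro powr_mono2') auto
  also have "\<dots> = ((s - 1) powr 2) powr (- ((\<nu> + 1) / 2)) * (\<nu> + 1) powr ((\<nu> + 1) / 2)"
    using assms by (simp add: powr_divide powr_minus_divide)
  also have "((s - 1) powr 2) powr (- ((\<nu> + 1) / 2)) = (s - 1) powr (- \<nu> - 1)"
  proof -
    have "2 * (- ((\<nu> + 1) / 2)) = - \<nu> - 1" by (simp add: field_simps)
    then show ?thesis by (simp only: powr_powr)
  qed
  finally have "(1 + s\<^sup>2 / \<nu>) powr (- ((\<nu> + 1) / 2)) \<le>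
      (s - 1) powr (- \<nu> - 1) * (\<nu> + 1) powr ((\<nu> + 1) / 2)" .
  from mult_left_mono[OF this, of "student_c \<nu>"] show ?thesis
    using assms student_c_pos[of \<nu>] by (simp add: student_density_def student_A_def mult_ac)
qed

lemma student_tail:
  assumes "0 < \<nu>" and "1 < t"
  shows "measure (student_measure \<nu>) {t..} \<le> student_A \<nu> / 2 * (t - 1) powr (- \<nu>)"
proof -
  define F where "F = (\<lambda>s. - (student_A \<nu> / 2 * (s - 1) powr (- \<nu>)))"
  define f where "f = (\<lambda>s. student_A \<nu> / 2 * \<nu> * (s - 1) powr (- \<nu> - 1))"
  have A: "0 \<le> student_A \<nu>"
    using assms student_c_pos[of \<nu>] by (simp add: student_A_def)
  have "emeasure (student_measure \<nu>) {t..} = 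
      (\<integral>\<^sup>+s. ennreal (student_density \<nu> s) * indicator {t..} s \<partial>lborel)"
    by (simp add: emeasure_density)
  also have "\<dots> \<le> (\<integral>\<^sup>+s. ennreal (f s) * indicator {t..} s \<partial>lborel)"
    using assms student_density_le_shifted_power[of \<nu>]
    by (intro nn_integral_mono) (force simp: f_def indicator_def intro!: ennreal_leI)
  also have "\<dots> = ennreal (0 - F t)"
  proof (rule nn_integral_FTC_atLeast)
    show "f \<in> borel_measurable borel" unfolding f_def by measurable
    show "DERIV F s :> f s" if "t \<le> s" for s
      unfolding F_def f_def using that assms
      by (auto intro!: derivative_eq_intros simp: powr_diff field_simps)
    show "0 \<le> f s" for s using A assms by (simp add: f_def)
    show "(F \<longlongrightarrow> 0) at_top"
      unfolding F_def using assms by real_asymp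
  qed
  finally have "emeasure (student_measure \<nu>) {t..} \<le> ennreal (- F t)" by simp
  moreover have "0 \<le> - F t" using A by (simp add: F_def)
  ultimately have "measure (student_measure \<nu>) {t..} \<le> - F t"
    unfolding measure_def by (metis enn2real_leI)
  then show ?thesis by (simp add: F_def)
qed

lemma student_measure_atMost_uminus:
  "measure (student_measure \<nu>) {..- t} = measure (student_measure \<nu>) {t..}"
proof -
  have "(\<integral>\<^sup>+s. ennreal (student_density \<nu> s) * indicator {..- t} s \<partial>lborel) =
    (\<integral>\<^sup>+s. ennreal (student_density \<nu> s) * indicator {t..} s \<partial>lborel)"
    by (subst nn_integral_real_affine[where c = "-1" and t = 0])
       (auto simp: student_density_minus indicator_def intro!: nn_integral_cong)
  then show ?thesis
    by (simp add: measure_def emeasure_density)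
qed

text \<open>If both tails at \<open>x\<close> have mass at least \<open>p\<close>, then by symmetry the tail beyond \<open>\<bar>x\<bar>\<close> has, and
the bound on that tail can be solved for \<open>\<bar>x\<bar>\<close>.\<close>
lemma student_quantile_bound:
  assumes "0 < \<nu>" and "0 < p"
    and "p \<le> density_cdf (student_density \<nu>) x"
    and "p \<le> 1 - density_cdf (student_density \<nu>) x"
  shows "\<bar>x\<bar> \<le> 1 + (student_A \<nu> / (2 * p)) powr (1 / \<nu>)"
proof (cases "\<bar>x\<bar> \<le> 1")
  case True
  then show ?thesis by (smt (verit) powr_ge_zero)
next
  case False
  interpret prob_space "student_measure \<nu>"
    by (rule prob_space_student[OF assms(1)])
  have "p \<le> measure (student_measure \<nu>) {\<bar>x\<bar>..}"
  proof (cases "0 \<le> x")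
    case True
    have "1 - prob {..x} = prob (space (student_measure \<nu>) - {..x})"
      by (rule prob_compl[symmetric]) simp
    also have "\<dots> \<le> prob {x..}"
      by (intro finite_measure_mono) auto
    finally show ?thesis
      using assms True by (simp add: density_cdf_def cdf_def)
  next
    case False
    then show ?thesis
      using assms student_measure_atMost_uminus[of \<nu> "- x"] by (simp add: density_cdf_def cdf_def)
  qed
  also have "\<dots> \<le> student_A \<nu> / 2 * (\<bar>x\<bar> - 1) powr (- \<nu>)"
    using False assms by (intro student_tail) auto
  finally have "(\<bar>x\<bar> - 1) powr \<nu> \<le> student_A \<nu> / (2 * p)"
    using False assms by (simp add: powr_minus field_simps)
  then have "((\<bar>x\<bar> - 1) powr \<nu>) powr (1 / \<nu>) \<le> (student_A \<nu> / (2 * p)) powr (1 / \<nu>)"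
    using assms by (intro powr_mono2) auto
  then show ?thesis
    using False assms by (simp add: powr_powr)
qed

section \<open>The constant\<close>

lemma student_A_pos: "0 < \<nu> \<Longrightarrow> 0 < student_A \<nu>"
  using student_c_pos[of \<nu>] by (simp add: student_A_def)

text \<open>Completing the square shows where the three summands in the constant come from: they are
\<open>1 + t\<^sup>2 / \<nu>\<close> at the quantile bound \<open>t = 1 + (A / (2 x)) powr (1 / \<nu>)\<close>.\<close>
lemma student_C_fun_eq:
  assumes "0 < \<nu>"
  shows "student_C_fun \<nu> \<eta> x =
    x * (1 + (1 + (student_A \<nu> / (2 * x)) powr (1 / \<nu>))\<^sup>2 / \<nu>) powr (\<eta> * (\<nu> + 1) / 2)"
proof -
  define u where "u = (student_A \<nu> / (2 * x)) powr (1 / \<nu>)"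
  have "(student_A \<nu> / (2 * x)) powr (2 / \<nu>) = u\<^sup>2"
    by (simp add: u_def power2_eq_square powr_add[symmetric])
  moreover have "(\<nu> + 1) / \<nu> + 2 / \<nu> * u + 1 / \<nu> * u\<^sup>2 = 1 + (1 + u)\<^sup>2 / \<nu>"
    using assms by (simp add: field_simps power2_eq_square)
  ultimately show ?thesis
    by (simp add: student_C_fun_def u_def)
qed

text \<open>The base of the power grows at most like \<open>x powr (-2 / \<nu>)\<close> as \<open>x\<close> tends to zero, and the exponent is
at most \<open>\<nu> / 2\<close>, so the power grows at most like \<open>1 / x\<close>.\<close>
lemma student_C_fun_le:
  assumes "0 < \<nu>" and "0 \<le> \<eta>" and "\<eta> \<le> \<nu> / (\<nu> + 1)" and "0 < x" and "x \<le> 1"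
  shows "student_C_fun \<nu> \<eta> x \<le> (1 + (1 + (student_A \<nu> / 2) powr (1 / \<nu>))\<^sup>2 / \<nu>) powr (\<nu> / 2)"
proof -
  define B where "B = (student_A \<nu> / 2) powr (1 / \<nu>)"
  define q where "q = x powr (1 / \<nu>)"
  define K where "K = 1 + (1 + B / q)\<^sup>2 / \<nu>"
  define D where "D = 1 + (1 + B)\<^sup>2 / \<nu>"
  have q: "0 < q" "q \<le> 1"
    using assms by (auto simp: q_def powr_le1)
  have B: "0 \<le> B" by (simp add: B_def)
  have "(student_A \<nu> / (2 * x)) powr (1 / \<nu>) = B / q"
    using assms student_A_pos[of \<nu>] by (simp add: B_def q_def flip: powr_divide)
  then have eq: "student_C_fun \<nu> \<eta> x = x * K powr (\<eta> * (\<nu> + 1) / 2)"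
    using assms by (simp add: student_C_fun_eq K_def)
  have K: "1 \<le> K" using assms by (simp add: K_def)
  have "1 + B / q \<le> (1 + B) / q"
    using q by (simp add: field_simps)
  then have "(1 + B / q)\<^sup>2 \<le> (1 + B)\<^sup>2 / q\<^sup>2"
    using q B power_mono[of "1 + B / q" "(1 + B) / q" 2] by (simp add: power_divide)
  then have "(1 + B / q)\<^sup>2 / \<nu> \<le> (1 + B)\<^sup>2 / q\<^sup>2 / \<nu>"
    using assms by (intro divide_right_mono) auto
  moreover have "1 \<le> 1 / q\<^sup>2" using q by (simp add: power_le_one)
  moreover have "D / q\<^sup>2 = 1 / q\<^sup>2 + (1 + B)\<^sup>2 / q\<^sup>2 / \<nu>"
    by (simp add: D_def add_divide_distrib mult.commute)
  ultimately have "K \<le> D / q\<^sup>2"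
    by (simp add: K_def)
  have D: "0 < D" using assms by (simp add: D_def add_pos_nonneg)
  have "\<eta> * (\<nu> + 1) / 2 \<le> \<nu> / 2" using assms by (simp add: field_simps)
  then have "K powr (\<eta> * (\<nu> + 1) / 2) \<le> K powr (\<nu> / 2)"
    using K by (rule powr_mono)
  also have "\<dots> \<le> (D / q\<^sup>2) powr (\<nu> / 2)"
    using \<open>K \<le> D / q\<^sup>2\<close> K assms by (intro powr_mono2) auto
  also have "\<dots> = D powr (\<nu> / 2) / (q powr 2) powr (\<nu> / 2)"
    using D q by (simp add: powr_divide)
  also have "(q powr 2) powr (\<nu> / 2) = x"
    unfolding q_def powr_powr using assms by simp
  finally have "K powr (\<eta> * (\<nu> + 1) / 2) \<le> D powr (\<nu> / 2) / x" .
  then show ?thesis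
    using assms by (simp add: eq D_def B_def field_simps)
qed

lemma student_C_fun_bdd_above:
  assumes "0 < \<nu>" and "0 \<le> \<eta>" and "\<eta> \<le> \<nu> / (\<nu> + 1)"
  shows "bdd_above (student_C_fun \<nu> \<eta> ` {0..1 / 2})"
proof (rule bdd_aboveI2)
  fix x :: real assume "x \<in> {0..1 / 2}"
  then show "student_C_fun \<nu> \<eta> x \<le> (1 + (1 + (student_A \<nu> / 2) powr (1 / \<nu>))\<^sup>2 / \<nu>) powr (\<nu> / 2)"
    using student_C_fun_le[OF assms, of x] by (cases "x = 0") (auto simp: student_C_fun_def)
qed

lemma student_C_fun_le_student_C:
  assumes "0 < \<nu>" and "0 \<le> \<eta>" and "\<eta> \<le> \<nu> / (\<nu> + 1)" and "0 \<le> x" and "x \<le> 1 / 2"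
  shows "student_C_fun \<nu> \<eta> x \<le> 2 * student_c \<nu> powr \<eta> * student_C \<nu> \<eta>"
proof -
  have "student_C_fun \<nu> \<eta> x \<le> (SUP x\<in>{0..1 / 2}. student_C_fun \<nu> \<eta> x)"
    using assms by (intro cSUP_upper student_C_fun_bdd_above) auto
  then show ?thesis
    using student_c_pos[OF assms(1)] by (simp add: student_C_def)
qed

lemma student_C_pos:
  assumes "0 < \<nu>" and "0 \<le> \<eta>" and "\<eta> \<le> \<nu> / (\<nu> + 1)"
  shows "0 < student_C \<nu> \<eta>"
proof -
  have "0 < 1 + (1 + (student_A \<nu>) powr (1 / \<nu>))\<^sup>2 / \<nu>"
    using assms by (simp add: add_pos_nonneg)
  then have "0 < student_C_fun \<nu> \<eta> (1 / 2)"
    using assms by (simp add: student_C_fun_eq)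
  also have "\<dots> \<le> 2 * student_c \<nu> powr \<eta> * student_C \<nu> \<eta>"
    using assms by (intro student_C_fun_le_student_C) auto
  finally show ?thesis
    using student_c_pos[OF assms(1)] by (simp add: zero_less_mult_iff)
qed

section \<open>The bounds of Assumption A\<close>

text \<open>The quantile bound at \<open>p = z / N\<close> is at most \<open>N powr (1 / \<nu>)\<close> times the one at \<open>z\<close>. This separates the
scale \<open>N\<close> of the cell from the relative position \<open>z\<close> inside it.\<close>
lemma student_density_growth:
  assumes "0 < \<nu>" and "0 \<le> \<eta>" and "1 \<le> N" and "0 < z"
    and "z / N \<le> density_cdf (student_density \<nu>) t"
    and "z / N \<le> 1 - density_cdf (student_density \<nu>) t"
  shows "z * student_density \<nu> t powr (- \<eta>) \<le>
           student_C_fun \<nu> \<eta> z * N powr ((\<nu> + 1) / \<nu> * \<eta>) / student_c \<nu> powr \<eta>"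
proof -
  define u where "u = (student_A \<nu> / (2 * z)) powr (1 / \<nu>)"
  define R where "R = N powr (1 / \<nu>)"
  define e where "e = \<eta> * (\<nu> + 1) / 2"
  note c = student_c_pos[OF assms(1)]
  have e: "0 \<le> e" using assms by (simp add: e_def)
  have R: "1 \<le> R" using assms by (simp add: R_def ge_one_powr_ge_zero)
  have "0 \<le> u" by (simp add: u_def)
  have "\<bar>t\<bar> \<le> 1 + (student_A \<nu> / (2 * (z / N))) powr (1 / \<nu>)"
    using assms by (intro student_quantile_bound) auto
  also have "(student_A \<nu> / (2 * (z / N))) powr (1 / \<nu>) = R * u"
    using assms student_A_pos[of \<nu>] by (simp add: R_def u_def mult.commute flip: powr_mult)
  also have "1 + R * u \<le> R * (1 + u)" using R by (simp add: distrib_left)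
  finally have "\<bar>t\<bar> \<le> R * (1 + u)" .
  then have "t\<^sup>2 \<le> R\<^sup>2 * (1 + u)\<^sup>2"
    using power_mono[of "\<bar>t\<bar>" "R * (1 + u)" 2] unfolding power_mult_distrib by simp
  then have "t\<^sup>2 / \<nu> \<le> R\<^sup>2 * (1 + u)\<^sup>2 / \<nu>"
    using assms by (intro divide_right_mono) auto
  moreover have "1 \<le> R\<^sup>2" using R by (simp add: one_le_power)
  ultimately have "1 + t\<^sup>2 / \<nu> \<le> R\<^sup>2 * (1 + (1 + u)\<^sup>2 / \<nu>)"
    by (simp add: distrib_left)
  then have "(1 + t\<^sup>2 / \<nu>) powr e \<le> (R powr 2 * (1 + (1 + u)\<^sup>2 / \<nu>)) powr e"
    using one_plus_square_over_pos[OF assms(1), of t] e R by (intro powr_mono2) auto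
  also have "\<dots> = (R powr 2) powr e * (1 + (1 + u)\<^sup>2 / \<nu>) powr e"
    by (rule powr_mult)
  also have "(R powr 2) powr e = N powr ((\<nu> + 1) / \<nu> * \<eta>)"
  proof -
    have "(R powr 2) powr e = N powr (1 / \<nu> * (2 * e))"
      by (simp only: R_def powr_powr mult.assoc)
    also have "1 / \<nu> * (2 * e) = (\<nu> + 1) / \<nu> * \<eta>"
      by (simp add: e_def)
    finally show ?thesis .
  qed
  finally have growth: "(1 + t\<^sup>2 / \<nu>) powr e \<le>
      N powr ((\<nu> + 1) / \<nu> * \<eta>) * (1 + (1 + u)\<^sup>2 / \<nu>) powr e" .
  have "student_density \<nu> t powr (- \<eta>) = student_c \<nu> powr (- \<eta>) * ((1 + t\<^sup>2 / \<nu>) powr (- ((\<nu> + 1) / 2))) powr (- \<eta>)"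
    unfolding student_density_def by (rule powr_mult)
  also have "\<dots> = (1 + t\<^sup>2 / \<nu>) powr e / student_c \<nu> powr \<eta>"
    unfolding powr_powr e_def by (simp add: powr_minus_divide mult_ac)
  finally have "z * student_density \<nu> t powr (- \<eta>) = z * (1 + t\<^sup>2 / \<nu>) powr e / student_c \<nu> powr \<eta>"
    by simp
  also have "\<dots> \<le> z * (N powr ((\<nu> + 1) / \<nu> * \<eta>) * (1 + (1 + u)\<^sup>2 / \<nu>) powr e) / student_c \<nu> powr \<eta>"
    using growth assms c by (intro divide_right_mono mult_left_mono) auto
  also have "\<dots> = student_C_fun \<nu> \<eta> z * N powr ((\<nu> + 1) / \<nu> * \<eta>) / student_c \<nu> powr \<eta>"
    using assms by (simp add: student_C_fun_eq u_def e_def)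
  finally show ?thesis .
qed

lemma student_transformed_bound:
  assumes "0 < \<nu>" and "0 \<le> \<eta>" and "\<eta> \<le> \<nu> / (\<nu> + 1)" and "a2 < a1" and "m < 2 ^ a2"
  shows "\<bar>transformed_int2 (student_density \<nu>) a1 a2 m t\<bar> / student_density \<nu> t powr \<eta> \<le>
     student_C \<nu> \<eta> * (2 powr (real a2 / 2) / 2 powr (real a1 + (1 - (\<nu> + 1) / \<nu> * \<eta>) * real a2))"
proof -
  interpret wavelet_cell a1 a2 m by unfold_locales (rule assms)
  define y where "y = density_cdf (student_density \<nu>) t"
  define d where "d = max 0 (min (y - left_end) (right_end - y))"
  define N :: real where "N = 2 ^ a2"
  define E where "E = (\<nu> + 1) / \<nu> * \<eta>"
  interpret S: prob_space "student_measure \<nu>"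
    by (rule prob_space_student[OF assms(1)])
  have y: "0 \<le> y" "y \<le> 1" by (auto simp: y_def density_cdf_def cdf_def)
  note dens = student_density_pos[OF assms(1), of t]
  note c = student_c_pos[OF assms(1)]
  note C = student_C_pos[OF assms(1-3)]
  have N: "1 \<le> N" by (simp add: N_def)
  have right_end: "right_end \<le> 1"
  proof -
    have "real (m + 1) \<le> real (2 ^ a2)" using assms by (intro of_nat_mono) simp
    then show ?thesis by (simp add: right_end_def field_simps)
  qed
  have "d * student_density \<nu> t powr (- \<eta>) \<le> 2 * student_C \<nu> \<eta> * N powr E / N"
  proof (cases "d = 0")
    case True
    then show ?thesis using C N by simp
  next
    case False
    \<comment> \<open>the distance to the boundary relative to the length of the cell\<close>
    define z where "z = N * d"
    have d: "0 < d" "d \<le> y - left_end" "d \<le> right_end - y" using False by (auto simp: d_def)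
    then have "2 * d \<le> 1 / N"
      by (auto simp: left_end_def right_end_def N_def add_divide_distrib)
    then have z: "0 < z" "z \<le> 1 / 2" "z / N = d"
      using d N by (auto simp: z_def field_simps)
    have "z * student_density \<nu> t powr (- \<eta>) \<le> student_C_fun \<nu> \<eta> z * N powr E / student_c \<nu> powr \<eta>"
      unfolding E_def using z d N assms(1,2) cell_order right_end
      by (intro student_density_growth) (auto simp: y_def[symmetric])
    also have "\<dots> \<le> (2 * student_c \<nu> powr \<eta> * student_C \<nu> \<eta>) * N powr E / student_c \<nu> powr \<eta>"
      using assms z c by (intro divide_right_mono mult_right_mono student_C_fun_le_student_C) auto
    finally have "z * student_density \<nu> t powr (- \<eta>) \<le> 2 * student_C \<nu> \<eta> * N powr E"
      using c by simp
    then show ?thesis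
      using N by (simp add: z_def field_simps)
  qed
  moreover have "\<bar>transformed_int2 (student_density \<nu>) a1 a2 m t\<bar> \<le> height / (2 * 2 ^ a1) * d"
    using wavelet_int2_bound[OF y(1)] by (simp add: transformed_int2_def y_def d_def)
  ultimately have "\<bar>transformed_int2 (student_density \<nu>) a1 a2 m t\<bar> * student_density \<nu> t powr (- \<eta>)
     \<le> height / (2 * 2 ^ a1) * (2 * student_C \<nu> \<eta> * N powr E / N)"
    by (smt (verit) height_def divide_nonneg_nonneg mult.assoc mult_left_mono mult_right_mono powr_ge_zero zero_le_power)
  also have "\<dots> = student_C \<nu> \<eta> * (height / (2 ^ a1 * N / N powr E))"
    by simp
  also have "2 ^ a1 * N / N powr E = 2 powr (real a1 + (1 - E) * real a2)"
    by (simp add: N_def powr_realpow[symmetric] powr_powr powr_add powr_diff right_diff_distrib mult.commute)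
  finally show ?thesis
    by (simp add: E_def height_def powr_minus_divide)
qed

lemma deriv_student_density:
  assumes "0 < \<nu>"
  shows "deriv (student_density \<nu>) x = - ((\<nu> + 1) / \<nu> * x * student_density \<nu> x / (1 + x\<^sup>2 / \<nu>))"
proof -
  note pos = one_plus_square_over_pos[OF assms, of x]
  let ?r = "- ((\<nu> + 1) / 2)"
  have "((\<lambda>x. 1 + x\<^sup>2 / \<nu>) has_real_derivative 2 * x / \<nu>) (at x)"
    using assms by (auto intro!: derivative_eq_intros)
  from DERIV_cmult[OF DERIV_fun_powr[OF this pos, of ?r], of "student_c \<nu>"]
  have "(student_density \<nu> has_real_derivative
      student_c \<nu> * (?r * (1 + x\<^sup>2 / \<nu>) powr (?r - 1) * (2 * x / \<nu>))) (at x)"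
    unfolding student_density_def by simp
  also have "student_c \<nu> * (?r * (1 + x\<^sup>2 / \<nu>) powr (?r - 1) * (2 * x / \<nu>)) =
      - ((\<nu> + 1) / \<nu> * x * student_density \<nu> x / (1 + x\<^sup>2 / \<nu>))"
  proof -
    have "(1 + x\<^sup>2 / \<nu>) powr (?r - 1) = (1 + x\<^sup>2 / \<nu>) powr ?r / (1 + x\<^sup>2 / \<nu>)"
      unfolding powr_diff using pos by simp
    moreover have "student_c \<nu> * (?r * (P / Q) * (2 * x / \<nu>)) =
        - ((\<nu> + 1) / \<nu> * x * (student_c \<nu> * P) / Q)" for P Q
      by (cases "Q = 0") (use assms in \<open>simp_all add: field_simps\<close>)
    ultimately show ?thesis
      unfolding student_density_def by (simp only:)
  qed
  finally have "(student_density \<nu> has_real_derivative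
      - ((\<nu> + 1) / \<nu> * x * student_density \<nu> x / (1 + x\<^sup>2 / \<nu>))) (at x)" .
  then show ?thesis by (rule DERIV_imp_deriv)
qed

text \<open>The power \<open>2 / (\<nu> + 1)\<close> of the density is \<open>1 / (1 + x\<^sup>2 / \<nu>)\<close> up to a constant, which is the factor by which
the logarithmic derivative of the density differs from a multiple of \<open>x\<close>.\<close>
lemma student_second_weight:
  assumes "0 < \<nu>"
  shows "(student_density \<nu> x)\<^sup>2 * ((\<nu> + 1) / \<nu> * (1 / student_c \<nu> powr (2 / (\<nu> + 1))) * \<bar>x\<bar> *
            student_density \<nu> x powr (\<eta> - 1 + 2 / (\<nu> + 1))) =
         \<bar>deriv (student_density \<nu>) x\<bar> * student_density \<nu> x powr \<eta>"
proof -
  define f where "f = student_density \<nu> x"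
  note pos = one_plus_square_over_pos[OF assms, of x]
  note c = student_c_pos[OF assms]
  have f: "0 < f" using student_density_pos[OF assms] by (simp add: f_def)
  have "f powr (2 / (\<nu> + 1)) = student_c \<nu> powr (2 / (\<nu> + 1)) *
      ((1 + x\<^sup>2 / \<nu>) powr (- ((\<nu> + 1) / 2))) powr (2 / (\<nu> + 1))"
    unfolding f_def student_density_def by (rule powr_mult)
  also have "((1 + x\<^sup>2 / \<nu>) powr (- ((\<nu> + 1) / 2))) powr (2 / (\<nu> + 1)) = 1 / (1 + x\<^sup>2 / \<nu>)"
  proof -
    have "- ((\<nu> + 1) / 2) * (2 / (\<nu> + 1)) = - 1" using assms by (simp add: field_simps)
    then show ?thesis
      unfolding powr_powr using pos by (simp only: powr_minus_divide) simp
  qed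
  finally have root: "f powr (2 / (\<nu> + 1)) = student_c \<nu> powr (2 / (\<nu> + 1)) / (1 + x\<^sup>2 / \<nu>)"
    by simp
  have "f powr (\<eta> - 1 + 2 / (\<nu> + 1)) = f powr \<eta> / f * f powr (2 / (\<nu> + 1))"
    using f by (simp add: powr_add powr_diff)
  then have "f\<^sup>2 * ((\<nu> + 1) / \<nu> * (1 / student_c \<nu> powr (2 / (\<nu> + 1))) * \<bar>x\<bar> * f powr (\<eta> - 1 + 2 / (\<nu> + 1)))
     = ((\<nu> + 1) / \<nu> * \<bar>x\<bar> * f / (1 + x\<^sup>2 / \<nu>)) * f powr \<eta>"
    unfolding root using f c by (simp add: power2_eq_square)
  also have "(\<nu> + 1) / \<nu> * \<bar>x\<bar> * f / (1 + x\<^sup>2 / \<nu>) = \<bar>deriv (student_density \<nu>) x\<bar>"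
    using assms f pos by (simp add: deriv_student_density f_def[symmetric] abs_mult)
  finally show ?thesis by (simp add: f_def)
qed

theorem proposition3:
  fixes \<nu> \<eta> \<beta> :: real and \<phi> \<psi> \<omega> :: "real \<Rightarrow> real"
  assumes "0 < \<nu>"
    and "0 \<le> \<eta>" and "\<eta> \<le> \<nu> / (\<nu> + 1)"
    and "\<phi> = student_density \<nu>"
    and "\<psi> = (\<lambda>x. student_density \<nu> x powr (\<eta> - 1))"
    and "\<omega> = (\<lambda>x. (\<nu> + 1) / \<nu> * (1 / student_c \<nu> powr (2 / (\<nu> + 1))) * \<bar>x\<bar> *
                     student_density \<nu> x powr (\<eta> - 1 + 2 / (\<nu> + 1)))"
    and "\<beta> = 1 - (\<nu> + 1) / \<nu> * \<eta>"
  shows "bdd_above (student_C_fun \<nu> \<eta> ` {0..1 / 2}) \<and>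
    0 < student_C \<nu> \<eta> \<and>
    assumption_A_bounds \<phi> \<psi> \<omega> (student_C \<nu> \<eta>) \<beta> \<and>
    (\<eta> < \<nu> / (\<nu> + 1) \<longrightarrow> assumption_A_with \<phi> \<psi> \<omega> (student_C \<nu> \<eta>) \<beta>)"
proof -
  note par = assms(1-3)
  have C: "0 < student_C \<nu> \<eta>" by (rule student_C_pos[OF par])
  have pos: "0 < \<phi> x" for x
    using student_density_pos[OF assms(1)] by (simp add: assms(4))
  have psi: "\<phi> x * \<psi> x = \<phi> x powr \<eta>" for x
    using pos[of x] by (simp add: assms(4,5) powr_diff)
  have omega: "(\<phi> x)\<^sup>2 * \<omega> x = \<bar>deriv \<phi> x\<bar> * \<phi> x powr \<eta>" for x
    unfolding assms(4,6) by (rule student_second_weight[OF assms(1)])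
  have bounds: "assumption_A_bounds \<phi> \<psi> \<omega> (student_C \<nu> \<eta>) \<beta>"
    unfolding assumption_A_bounds_def
  proof (intro allI impI conjI SUP_least)
    fix a1 a2 m :: nat and x :: real
    assume am: "a2 < a1" "m < 2 ^ a2"
    let ?W = "transformed_int2 \<phi> a1 a2 m x"
    let ?b = "student_C \<nu> \<eta> * (2 powr (real a2 / 2) / 2 powr (real a1 + \<beta> * real a2))"
    have W: "\<bar>?W\<bar> / \<phi> x powr \<eta> \<le> ?b"
      unfolding assms(4,7) by (rule student_transformed_bound[OF par am])
    show "ereal \<bar>?W\<bar> / ereal (\<phi> x * \<psi> x) \<le> ereal ?b"
      using W pos[of x] by (simp add: psi)
    show "ereal \<bar>?W * deriv \<phi> x\<bar> / ereal ((\<phi> x)\<^sup>2 * \<omega> x) \<le> ereal ?b"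
    proof (cases "deriv \<phi> x = 0")
      \<comment> \<open>This is the origin, where numerator and denominator both vanish and the quotient is \<open>0\<close>.\<close>
      case True
      then show ?thesis using C by (simp add: omega zero_ereal_def[symmetric])
    next
      case False
      then show ?thesis
        using W pos[of x] by (simp add: omega abs_mult)
    qed
  qed
  moreover have "assumption_A_with \<phi> \<psi> \<omega> (student_C \<nu> \<eta>) \<beta>" if "\<eta> < \<nu> / (\<nu> + 1)"
  proof -
    have "(\<nu> + 1) / \<nu> * \<eta> < 1" "0 \<le> (\<nu> + 1) / \<nu> * \<eta>"
      using that assms(1,2) by (simp_all add: field_simps)
    then show ?thesis
      using C bounds by (simp add: assumption_A_with_def assms(7))
  qed
  ultimately show ?thesis
    using C student_C_fun_bdd_above[OF par] by blast
qed

end
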